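(* Let $p$ be an odd prime and let $G=D_p\times D_p$, a group of order $4p^2$. Then the spectrum of the adjacency matrix $A(\mathcal{S}_{D_p\times D_p})$, as a multiset of $4p^2$ eigenvalues, consists of $-1$ taken $4p^2-4$ times, together with the remaining four eigenvalues, which are the roots (with multiplicity) of the equation $$\lambda^4+A\lambda^3+B\lambda^2+C\lambda+D=0,$$ where $A=4-4p^2$, $B=p^4+2p^3-13p^2-2p+6$, $C=2p^6+2p^5-3p^4+4p^3-11p^2-6p+4$, $D=2p^6+2p^5-4p^4+2p^3-2p^2-4p+1$.
   Context: $D_n$ denotes the dihedral group of order $2n$, generated by $a,b$ with $o(a)=n$, $o(b)=2$, $ba=a^{-1}b$; $o(x)$ is the order of a group element $x$. For a finite group $G$, the superpower graph $\mathcal{S}_G$ is the simple undirected graph whose vertex set is $G$, with two distinct vertices $x,y$ adjacent if and only if $o(x)\mid o(y)$ or $o(y)\mid o(x)$. $A(\Gamma)$ denotes the adjacency matrix of a graph $\Gamma$. The spectrum is the multiset of eigenvalues counted with multiplicity; the roots of the quartic may coincide with $-1$, in which case multiplicities add. *)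

theory Defs
  imports
    "HOL-Algebra.Generated_Groups"
    "HOL-Algebra.Multiplicative_Group"
    "HOL-Computational_Algebra.Computational_Algebra"
    "Jordan_Normal_Form.Char_Poly"
    "Graph_Theory.Pair_Digraph"
begin

section \<open>Dihedral groups\<close>

text \<open>A group is dihedral of order \<open>2n\<close> if it has the usual presentation data. These
  conditions determine the group up to isomorphism; a concrete model is given below.\<close>

definition is_dihedral :: "nat \<Rightarrow> ('a, 'm) monoid_scheme \<Rightarrow> bool" where
  "is_dihedral n D \<longleftrightarrow> group D \<and> Coset.order D = 2 * n \<and>
     (\<exists>a\<in>carrier D. \<exists>b\<in>carrier D.
        generate D {a, b} = carrier D \<and> group.ord D a = n \<and> group.ord D b = 2 \<and>
        b \<otimes>\<^bsub>D\<^esub> a = inv\<^bsub>D\<^esub> a \<otimes>\<^bsub>D\<^esub> b)"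

text \<open>The pair \<open>(i, s)\<close> with \<open>0 \<le> i < n\<close> and \<open>s = \<plusminus>1\<close> stands for the map
  \<open>x \<mapsto> s x + i\<close> on the integers modulo \<open>n\<close> (formally, so that both signs are kept apart
  also for \<open>n \<le> 2\<close>).\<close>

definition dihedral_model :: "nat \<Rightarrow> (int \<times> int) monoid" where
  "dihedral_model n =
     \<lparr>carrier = {0..<int n} \<times> {1, -1},
      monoid.mult = (\<lambda>(i, s) (j, t). ((i + s * j) mod int n, s * t)),
      one = (0, 1)\<rparr>"

lemma group_dihedral_model:
  assumes "n > 0"
  shows "group (dihedral_model n)"
proof (rule groupI)
  fix x y z
  assume "x \<in> carrier (dihedral_model n)" "y \<in> carrier (dihedral_model n)"
    "z \<in> carrier (dihedral_model n)"
  thus "x \<otimes>\<^bsub>dihedral_model n\<^esub> y \<otimes>\<^bsub>dihedral_model n\<^esub> z =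
    x \<otimes>\<^bsub>dihedral_model n\<^esub> (y \<otimes>\<^bsub>dihedral_model n\<^esub> z)"
    by (auto simp: dihedral_model_def mod_simps algebra_simps)
next
  fix x assume "x \<in> carrier (dihedral_model n)"
  then obtain i s where x: "x = (i, s)" "0 \<le> i" "i < int n" "s = 1 \<or> s = -1"
    by (auto simp: dihedral_model_def)
  show "\<exists>y\<in>carrier (dihedral_model n). y \<otimes>\<^bsub>dihedral_model n\<^esub> x = \<one>\<^bsub>dihedral_model n\<^esub>"
    using x assms by (intro bexI[of _ "((- s * i) mod int n, s)"])
      (auto simp: dihedral_model_def mod_simps)
qed (use assms in \<open>auto simp: dihedral_model_def\<close>)

lemma is_dihedral_model:
  assumes "n > 0"
  shows "is_dihedral n (dihedral_model n)"
proof -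
  let ?D = "dihedral_model n"
  interpret D: group ?D by (rule group_dihedral_model[OF assms])
  define a :: "int \<times> int" where "a = (1 mod int n, 1)"
  define b :: "int \<times> int" where "b = (0, -1)"
  have ab: "a \<in> carrier ?D" "b \<in> carrier ?D"
    using assms by (auto simp: a_def b_def dihedral_model_def)
  have pow_a: "a [^]\<^bsub>?D\<^esub> k = (int k mod int n, 1)" for k :: nat
    by (induction k) (auto simp: a_def dihedral_model_def mod_simps add.commute)
  have ord_a: "D.ord a = n"
  proof (rule dvd_antisym)
    show "D.ord a dvd n"
      using pow_a[of n] D.pow_eq_id[OF ab(1), of n] by (simp add: dihedral_model_def)
    have "a [^]\<^bsub>?D\<^esub> D.ord a = \<one>\<^bsub>?D\<^esub>" using ab by simp
    thus "n dvd D.ord a"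
      unfolding pow_a by (simp add: dihedral_model_def mod_eq_0_iff_dvd)
  qed
  have b: "b \<noteq> \<one>\<^bsub>?D\<^esub>" "b \<otimes>\<^bsub>?D\<^esub> b = \<one>\<^bsub>?D\<^esub>"
    by (auto simp: b_def dihedral_model_def)
  have ord_b: "D.ord b = 2"
  proof -
    have "D.ord b dvd 2"
      using b(2) ab D.pow_eq_id[OF ab(2), of 2]
      by (simp add: numeral_2_eq_2)
    moreover have "D.ord b \<noteq> 1"
      using b(1) ab D.pow_eq_id[OF ab(2), of 1] by auto
    ultimately show ?thesis by (metis prime_nat_iff two_is_prime_nat)
  qed
  have inv_a: "inv\<^bsub>?D\<^esub> a = ((-1) mod int n, 1)"
    by (rule D.inv_equality) (use ab assms in \<open>auto simp: a_def dihedral_model_def mod_simps\<close>)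
  have rel: "b \<otimes>\<^bsub>?D\<^esub> a = inv\<^bsub>?D\<^esub> a \<otimes>\<^bsub>?D\<^esub> b"
    unfolding inv_a by (auto simp: a_def b_def dihedral_model_def mod_simps)
  have pow_gen: "a [^]\<^bsub>?D\<^esub> k \<in> generate ?D {a, b}" for k :: nat
    by (induction k) (auto intro: generate.intros)
  have "x \<in> generate ?D {a, b}" if "x \<in> carrier ?D" for x
  proof -
    from that obtain i s where x: "x = (i, s)" "0 \<le> i" "i < int n" "s = 1 \<or> s = -1"
      by (auto simp: dihedral_model_def)
    have i: "a [^]\<^bsub>?D\<^esub> nat i = (i, 1)" using x by (simp add: pow_a)
    show ?thesis
    proof (cases "s = 1")
      case True
      thus ?thesis using pow_gen[of "nat i"] i x by simp
    next
      case False
      hence "x = a [^]\<^bsub>?D\<^esub> nat i \<otimes>\<^bsub>?D\<^esub> b"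
        using x by (auto simp: i b_def) (auto simp: dihedral_model_def)
      thus ?thesis using pow_gen[of "nat i"] by (auto intro: generate.intros)
    qed
  qed
  hence gen: "generate ?D {a, b} = carrier ?D"
    using ab D.generate_incl[of "{a, b}"] by auto
  have "Coset.order ?D = 2 * n"
    by (simp add: Coset.order_def dihedral_model_def card_cartesian_product)
  with D.is_group ab gen ord_a ord_b rel show ?thesis
    unfolding is_dihedral_def by blast
qed

section \<open>Superpower graphs\<close>

text \<open>Simple undirected graphs are represented by symmetric loop-free sets of pairs.\<close>

definition superpower_graph :: "('a, 'm) monoid_scheme \<Rightarrow> 'a pair_pre_digraph" where
  "superpower_graph G =
     \<lparr>pverts = carrier G,
      parcs = {(x, y). x \<in> carrier G \<and> y \<in> carrier G \<and> x \<noteq> y \<and>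
                 (group.ord G x dvd group.ord G y \<or> group.ord G y dvd group.ord G x)}\<rparr>"

lemma pair_graph_superpower_graph:
  assumes "finite (carrier G)"
  shows "pair_graph (superpower_graph G)"
proof
  have "parcs (superpower_graph G) \<subseteq> carrier G \<times> carrier G"
    by (auto simp: superpower_graph_def)
  thus "finite (parcs (superpower_graph G))"
    using assms by (meson finite_SigmaI finite_subset)
qed (use assms in \<open>auto simp: superpower_graph_def symmetric_def arcs_ends_def
       arc_to_ends_def with_proj_def intro!: symI\<close>)

section \<open>Adjacency matrices and their spectra\<close>

text \<open>The rows and columns are ordered by a list \<open>vs\<close> which is meant to enumerate the
  vertices without repetition.\<close>

definition adjacency_matrix :: "'a pair_pre_digraph \<Rightarrow> 'a list \<Rightarrow> complex mat" where
  "adjacency_matrix \<Gamma> vs =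
     mat (length vs) (length vs) (\<lambda>(i, j). if (vs ! i, vs ! j) \<in> parcs \<Gamma> then 1 else 0)"

text \<open>Eigenvalues with algebraic multiplicity. Over the complex numbers an \<open>n \<times> n\<close> matrix
  has exactly \<open>n\<close> of them.\<close>

definition spectrum_mset :: "complex mat \<Rightarrow> complex multiset" where
  "spectrum_mset M = proots (char_poly M)"

end

(* The order of an element of D_p x D_p divides 2p, so only elements of order p and of order 2 are
   incomparable: A + I is constant on the blocks of a partition of the vertices into the
   a = p^2 - 1 elements of order p, the b = p^2 + 2p elements of order 2 and the m = 2p^2 - 2p + 1
   remaining ones, which dominate the graph. By Sylvester's determinant identity the characteristic
   polynomial in t = x + 1 is t^(4p^2 - 3) times the one of the 3 x 3 quotient matrix, which is
   t^3 - 4p^2 t^2 + a b t + m a b. The quartic is t times this cubic. *)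
theory Submission
  imports Defs
begin

section \<open>Determinants of block-constant matrices\<close>

text \<open>Both sides equal \<open>t ^ k\<close> times the determinant of the block matrix
  \<open>?M\<close>: \<open>?L\<close> on the right and \<open>?K\<close> on the left each clear its
  lower left block. Nothing is divided by \<open>t\<close>, so an integral domain suffices and
  \<open>t = 0\<close> is allowed.\<close>

lemma det_sylvester:
  fixes P R :: "'a :: idom mat"
  assumes P: "P \<in> carrier_mat n k" and R: "R \<in> carrier_mat k n"
  shows "t ^ k * det (t \<cdot>\<^sub>m 1\<^sub>m n - P * R) = t ^ n * det (t \<cdot>\<^sub>m 1\<^sub>m k - R * P)"
proof -
  let ?M = "four_block_mat (t \<cdot>\<^sub>m 1\<^sub>m n) P R (1\<^sub>m k)"
  have PR: "P * R \<in> carrier_mat n n" and RP: "R * P \<in> carrier_mat k k"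
    using P R by auto
  have M: "?M \<in> carrier_mat (n + k) (n + k)" by auto
  let ?L = "four_block_mat (1\<^sub>m n) (0\<^sub>m n k) (- R) (1\<^sub>m k)"
  have "?M * ?L = four_block_mat (t \<cdot>\<^sub>m 1\<^sub>m n - P * R) P (0\<^sub>m k n) (1\<^sub>m k)"
    by (subst mult_four_block_mat[of _ n n _ k _ k _ _ n _ k])
      (use P R PR in \<open>auto simp: minus_add_uminus_mat\<close>)
  moreover have "det ?L = 1"
    by (subst det_four_block_mat_upper_right_zero[of _ n _ k]) (use R in auto)
  moreover have "det (?M * ?L) = det ?M * det ?L"
    by (rule det_mult[of _ "n + k"]) auto
  ultimately have 1: "det ?M = det (t \<cdot>\<^sub>m 1\<^sub>m n - P * R)"
    using P PR det_four_block_mat_lower_left_zero[of "t \<cdot>\<^sub>m 1\<^sub>m n - P * R" n P k "0\<^sub>m k n" "1\<^sub>m k"]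
    by (simp add: minus_carrier_mat)
  \<comment> \<open>The corner \<open>t\<close> makes the lower left block of \<open>?K * ?M\<close>
    equal to t R - t R = 0; its price is the factor \<open>t ^ k\<close>.\<close>
  let ?K = "four_block_mat (1\<^sub>m n) (0\<^sub>m n k) (- R) (t \<cdot>\<^sub>m 1\<^sub>m k)"
  have "?K * ?M = four_block_mat (t \<cdot>\<^sub>m 1\<^sub>m n) P (0\<^sub>m k n) (t \<cdot>\<^sub>m 1\<^sub>m k - R * P)"
    by (subst mult_four_block_mat[of _ n n _ k _ k _ _ n _ k])
      (use P R RP in \<open>auto simp: minus_add_uminus_mat\<close>)
  moreover have "det ?K = t ^ k"
    by (subst det_four_block_mat_upper_right_zero[of _ n _ k]) (use R in auto)
  moreover have "det (?K * ?M) = det ?K * det ?M"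
    by (rule det_mult[of _ "n + k"]) auto
  ultimately have "t ^ k * det ?M = t ^ n * det (t \<cdot>\<^sub>m 1\<^sub>m k - R * P)"
    using P RP det_four_block_mat_lower_left_zero
        [of "t \<cdot>\<^sub>m 1\<^sub>m n" n P k "0\<^sub>m k n" "t \<cdot>\<^sub>m 1\<^sub>m k - R * P"]
    by (simp add: minus_carrier_mat)
  with 1 show ?thesis by simp
qed

text \<open>The right-hand matrix is the quotient matrix of the partition given by the classes of \<open>c\<close>;
  the factor \<open>t ^ k\<close> avoids the truncated exponent \<open>n - k\<close>.\<close>

lemma det_block_constant:
  fixes S :: "nat \<Rightarrow> nat \<Rightarrow> 'a :: idom"
  assumes c: "\<And>i. i < n \<Longrightarrow> c i < k"
  shows "t ^ k * det (mat n n (\<lambda>(i, j). (if i = j then t else 0) - S (c i) (c j))) =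
    t ^ n * det (mat k k (\<lambda>(r, l). (if r = l then t else 0) - S r l * of_nat (card {i. i < n \<and> c i = l})))"
proof -
  \<comment> \<open>\<open>P\<close> is the incidence matrix of indices and classes, so
    \<open>P * R\<close> spreads \<open>S\<close> over the blocks, while \<open>R * P\<close> sums
    over each class and produces its cardinality.\<close>
  define P :: "'a mat" where "P = mat n k (\<lambda>(i, l). if c i = l then 1 else 0)"
  define R :: "'a mat" where "R = mat k n (\<lambda>(l, j). S l (c j))"
  have "t \<cdot>\<^sub>m 1\<^sub>m n - P * R = mat n n (\<lambda>(i, j). (if i = j then t else 0) - S (c i) (c j))"
    using c by (intro eq_matI)
      (auto simp: P_def R_def scalar_prod_def if_distrib[of "\<lambda>x. x * _"] sum.delta cong: if_cong)
  moreover have "t \<cdot>\<^sub>m 1\<^sub>m k - R * P =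
      mat k k (\<lambda>(r, l). (if r = l then t else 0) - S r l * of_nat (card {i. i < n \<and> c i = l}))"
  proof (rule eq_matI, goal_cases)
    case (1 r l)
    have "(\<Sum>i = 0..<n. S r (c i) * (if c i = l then 1 else 0)) = (\<Sum>i \<in> {i. i < n \<and> c i = l}. S r l)"
      by (rule sum.mono_neutral_cong_right) auto
    with 1 show ?case
      by (auto simp: P_def R_def scalar_prod_def mult.commute)
  qed (auto simp: P_def R_def)
  ultimately show ?thesis
    using det_sylvester[of P n k R t] by (simp add: P_def R_def)
qed

lemma det_mat_3:
  "det (mat 3 3 f :: 'a :: comm_ring_1 mat) =
     f (0,0) * (f (1,1) * f (2,2) - f (1,2) * f (2,1))
   - f (0,1) * (f (1,0) * f (2,2) - f (1,2) * f (2,0))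
   + f (0,2) * (f (1,0) * f (2,1) - f (1,1) * f (2,0))"
proof -
  have det2: "det M = M $$ (0,0) * M $$ (1,1) - M $$ (0,1) * M $$ (1,0)"
    if "M \<in> carrier_mat 2 2" for M :: "'a mat"
    using that by (subst laplace_expansion_row[of _ 2 0])
      (auto simp: numeral_2_eq_2 cofactor_def mat_delete_def det_single)
  show ?thesis
    by (subst laplace_expansion_row[of _ 3 0])
      (auto simp: eval_nat_numeral cofactor_def mat_delete_def det2[unfolded eval_nat_numeral] algebra_simps)
qed

section \<open>Element orders in direct products and dihedral groups\<close>

text \<open>Powers are componentwise, so the two numbers have the same multiples.\<close>

lemma ord_DirProd:
  assumes "group G" "group H" "x \<in> carrier G" "y \<in> carrier H"
  shows "group.ord (G \<times>\<times> H) (x, y) = lcm (group.ord G x) (group.ord H y)"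
proof -
  interpret G: group G by fact
  interpret H: group H by fact
  interpret GH: group "G \<times>\<times> H" by (rule DirProd_group) fact+
  have pow: "(x, y) [^]\<^bsub>G \<times>\<times> H\<^esub> n = (x [^]\<^bsub>G\<^esub> n, y [^]\<^bsub>H\<^esub> n)" for n :: nat
    by (induction n) auto
  have "GH.ord (x, y) dvd n \<longleftrightarrow> lcm (G.ord x) (H.ord y) dvd n" for n
    using assms(3,4) by (simp flip: GH.pow_eq_id G.pow_eq_id H.pow_eq_id add: pow)
  thus ?thesis by (meson dvd_antisym dvd_refl)
qed

text \<open>Divisibility of the order splits over the two components, whereas equality does not;
  this is why orders are counted up to \<open>dvd\<close> first.\<close>

lemma card_ord_dvd_DirProd:
  assumes "group G" "group H"
  shows "card {v \<in> carrier (G \<times>\<times> H). group.ord (G \<times>\<times> H) v dvd n} =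
    card {x \<in> carrier G. group.ord G x dvd n} * card {y \<in> carrier H. group.ord H y dvd n}"
proof -
  have "{v \<in> carrier (G \<times>\<times> H). group.ord (G \<times>\<times> H) v dvd n} =
    {x \<in> carrier G. group.ord G x dvd n} \<times> {y \<in> carrier H. group.ord H y dvd n}"
    using ord_DirProd[OF assms] by auto
  thus ?thesis by (simp add: card_cartesian_product)
qed

text \<open>The rotations, the powers of \<open>a\<close>, have order dividing \<open>n\<close>, and
  the elements outside are reflections, of order dividing 2. As \<open>n\<close> is odd, only the
  identity satisfies both conditions.\<close>

lemma dihedral_ord_counts:
  assumes D: "is_dihedral n D" and n: "odd n"
  shows "card {x \<in> carrier D. group.ord D x dvd n} = n"
    and "card {x \<in> carrier D. group.ord D x dvd 2} = n + 1"
proof -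
  from D obtain a b where group: "group D" and order: "Coset.order D = 2 * n"
    and a: "a \<in> carrier D" "group.ord D a = n" and b: "b \<in> carrier D" "group.ord D b = 2"
    and rel: "b \<otimes>\<^bsub>D\<^esub> a = inv\<^bsub>D\<^esub> a \<otimes>\<^bsub>D\<^esub> b"
    unfolding is_dihedral_def by blast
  interpret group D by fact
  have n0: "n > 0" using n by presburger
  have card: "card (carrier D) = 2 * n" using order by (simp add: Coset.order_def)
  have fin: "finite (carrier D)" using card n0 by (intro card_ge_0_finite) simp
  define R where "R = (\<lambda>k::nat. a [^]\<^bsub>D\<^esub> k) ` UNIV"
  have R: "R \<subseteq> carrier D" using a by (auto simp: R_def)
  have R_gen: "R = generate D {a}"
    unfolding R_def using generate_pow_on_finite_carrier[OF fin a(1)] by auto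
  have cR: "card R = n"
    unfolding R_gen using generate_pow_card[OF a(1)] a(2) by simp
  have R_ord: "ord x dvd n" if "x \<in> R" for x
  proof -
    from that obtain k :: nat where x: "x = a [^]\<^bsub>D\<^esub> k" by (auto simp: R_def)
    show ?thesis using a by (simp add: x flip: pow_eq_id) (simp add: nat_pow_pow mult.commute pow_eq_id)
  qed
  have bR: "b \<notin> R" using R_ord[of b] b n by auto
  have conj: "b \<otimes>\<^bsub>D\<^esub> a [^]\<^bsub>D\<^esub> k = inv\<^bsub>D\<^esub> (a [^]\<^bsub>D\<^esub> k) \<otimes>\<^bsub>D\<^esub> b" for k :: nat
  proof (induction k)
    case (Suc k)
    have "b \<otimes>\<^bsub>D\<^esub> a [^]\<^bsub>D\<^esub> Suc k = inv\<^bsub>D\<^esub> (a [^]\<^bsub>D\<^esub> k) \<otimes>\<^bsub>D\<^esub> (b \<otimes>\<^bsub>D\<^esub> a)"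
      using a b by (simp add: Suc flip: m_assoc)
    also have "\<dots> = inv\<^bsub>D\<^esub> (a \<otimes>\<^bsub>D\<^esub> a [^]\<^bsub>D\<^esub> k) \<otimes>\<^bsub>D\<^esub> b"
      using a b by (simp add: rel inv_mult_group m_assoc)
    also have "a \<otimes>\<^bsub>D\<^esub> a [^]\<^bsub>D\<^esub> k = a [^]\<^bsub>D\<^esub> Suc k"
      using nat_pow_Suc2[OF a(1)] by metis
    finally show ?case .
  qed (use b in simp)
  have bb: "b \<otimes>\<^bsub>D\<^esub> b = \<one>\<^bsub>D\<^esub>"
    using pow_ord_eq_1[OF b(1)] b by (simp add: numeral_2_eq_2)
  \<comment> \<open>Moving \<open>b\<close> past \<open>x\<close> inverts \<open>x\<close>, so the
    square of the reflection collapses.\<close>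
  have Rb_ord: "x \<otimes>\<^bsub>D\<^esub> b \<otimes>\<^bsub>D\<^esub> (x \<otimes>\<^bsub>D\<^esub> b) = \<one>\<^bsub>D\<^esub>" if "x \<in> R" for x
  proof -
    from that obtain k :: nat where x: "x = a [^]\<^bsub>D\<^esub> k" by (auto simp: R_def)
    have "x \<otimes>\<^bsub>D\<^esub> b \<otimes>\<^bsub>D\<^esub> (x \<otimes>\<^bsub>D\<^esub> b) = x \<otimes>\<^bsub>D\<^esub> (b \<otimes>\<^bsub>D\<^esub> x) \<otimes>\<^bsub>D\<^esub> b"
      using a b by (simp add: x m_assoc)
    also have "b \<otimes>\<^bsub>D\<^esub> x = inv\<^bsub>D\<^esub> x \<otimes>\<^bsub>D\<^esub> b" by (simp only: x conj)
    also have "x \<otimes>\<^bsub>D\<^esub> (inv\<^bsub>D\<^esub> x \<otimes>\<^bsub>D\<^esub> b) \<otimes>\<^bsub>D\<^esub> b = x \<otimes>\<^bsub>D\<^esub> inv\<^bsub>D\<^esub> x \<otimes>\<^bsub>D\<^esub> (b \<otimes>\<^bsub>D\<^esub> b)"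
      using a b by (simp add: x flip: m_assoc)
    finally show ?thesis using a by (simp add: bb x)
  qed
  have sub: "subgroup R D" unfolding R_gen using a by (intro generate_is_subgroup) auto
  \<comment> \<open>The coset of \<open>b\<close> is disjoint from \<open>R\<close> and equally
    large, so together they have 2n elements and exhaust the group.\<close>
  have carrier: "carrier D = R \<union> (\<lambda>x. x \<otimes>\<^bsub>D\<^esub> b) ` R" and disj: "R \<inter> (\<lambda>x. x \<otimes>\<^bsub>D\<^esub> b) ` R = {}"
  proof -
    have "x \<otimes>\<^bsub>D\<^esub> b \<notin> R" if "x \<in> R" for x
    proof
      assume "x \<otimes>\<^bsub>D\<^esub> b \<in> R"
      hence "inv\<^bsub>D\<^esub> x \<otimes>\<^bsub>D\<^esub> (x \<otimes>\<^bsub>D\<^esub> b) \<in> R"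
        using that sub by (meson subgroup.m_closed subgroup.m_inv_closed)
      thus False using that bR R b by (auto simp flip: m_assoc)
    qed
    thus disj: "R \<inter> (\<lambda>x. x \<otimes>\<^bsub>D\<^esub> b) ` R = {}" by auto
    have finR: "finite R" using R fin by (rule finite_subset)
    have "card ((\<lambda>x. x \<otimes>\<^bsub>D\<^esub> b) ` R) = n"
      using cR R b by (subst card_image) (auto simp: inj_on_def dest!: subsetD[OF R])
    hence "card (R \<union> (\<lambda>x. x \<otimes>\<^bsub>D\<^esub> b) ` R) = 2 * n"
      using disj finR cR by (simp add: card_Un_disjoint)
    thus "carrier D = R \<union> (\<lambda>x. x \<otimes>\<^bsub>D\<^esub> b) ` R"
      using card fin R b by (intro card_subset_eq[symmetric]) auto
  qed
  have ord2: "ord x dvd 2" if "x \<in> carrier D - R" for x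
  proof -
    from that have "x \<otimes>\<^bsub>D\<^esub> x = \<one>\<^bsub>D\<^esub>" using carrier Rb_ord by auto
    thus ?thesis using that by (simp flip: pow_eq_id add: numeral_2_eq_2)
  qed
  have one: "x = \<one>\<^bsub>D\<^esub>" if "x \<in> carrier D" "ord x dvd n" "ord x dvd 2" for x
  proof -
    have "ord x dvd gcd n 2" using that by simp
    hence "ord x = 1" using n by simp
    thus ?thesis using that ord_eq_1 by blast
  qed
  have oneR: "\<one>\<^bsub>D\<^esub> \<in> R" using sub by (rule subgroup.one_closed)
  have "{x \<in> carrier D. ord x dvd n} = R"
    using R R_ord ord2 one oneR by blast
  thus "card {x \<in> carrier D. ord x dvd n} = n" using cR by simp
  have "{x \<in> carrier D. ord x dvd 2} = insert \<one>\<^bsub>D\<^esub> (carrier D - R)"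
    using R R_ord ord2 one oneR by auto
  also have "card \<dots> = n + 1"
    using oneR fin R cR card finite_subset[OF R fin] by (simp add: card_Diff_subset)
  finally show "card {x \<in> carrier D. ord x dvd 2} = n + 1" .
qed

section \<open>The characteristic polynomial and the spectrum\<close>

text \<open>The cube on the left is the factor \<open>t ^ k\<close> of
  \<open>det_block_constant\<close> for three classes. The first factor of the constant term counts
  the elements of order 1 or 2p.\<close>

lemma char_poly_superpower_dihedral_square:
  assumes p: "Factorial_Ring.prime p" "odd p" and D: "is_dihedral p D"
    and vs: "distinct vs" "set vs = carrier (D \<times>\<times> D)"
  shows "[:1, 1:] ^ 3 * char_poly (adjacency_matrix (superpower_graph (D \<times>\<times> D)) vs) =
    [:1, 1:] ^ (4 * p ^ 2) *
      ([:1, 1:] ^ 3 - of_nat (4 * p ^ 2) * [:1, 1:] ^ 2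
       + of_nat ((p ^ 2 - 1) * (p ^ 2 + 2 * p)) * [:1, 1:]
       + of_nat ((4 * p ^ 2 - (p ^ 2 - 1) - (p ^ 2 + 2 * p)) * (p ^ 2 - 1) * (p ^ 2 + 2 * p)))"
proof -
  let ?G = "D \<times>\<times> D"
  have D_group: "group D" and order: "card (carrier D) = 2 * p"
    using D by (auto simp: is_dihedral_def Coset.order_def)
  interpret D: group D by fact
  interpret G: group ?G by (rule DirProd_group) fact+
  have p3: "p \<ge> 3" using p prime_ge_2_nat[of p] by (cases "p = 2") auto
  have fin: "finite (carrier ?G)" using vs(2) by (metis List.finite_set)
  have card_G: "card (carrier ?G) = 4 * p ^ 2"
    by (simp add: card_cartesian_product order power2_eq_square)
  have len: "length vs = 4 * p ^ 2"
    using distinct_card[OF vs(1)] by (simp only: vs(2) card_G)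
  have ord_cases: "G.ord v \<in> {1, 2, p, 2 * p}" if "v \<in> carrier ?G" for v
  proof -
    have "D.ord x dvd 2 * p" if "x \<in> carrier D" for x
      using D.ord_dvd_group_order[OF that] by (simp add: Coset.order_def order)
    hence "G.ord v dvd 2 * p"
      using that ord_DirProd[OF D_group D_group] by auto
    then obtain i j where ij: "G.ord v = i * j" "i dvd 2" "j dvd p"
      by (rule division_decomp[elim_format]) blast
    moreover have "i = 1 \<or> i = 2" using ij(2) two_is_prime_nat prime_nat_iff by blast
    moreover have "j = 1 \<or> j = p" using ij(3) p(1) prime_nat_iff by blast
    ultimately show ?thesis by auto
  qed
  \<comment> \<open>Class 0 collects the orders 1 and 2p, which are comparable with every order that
    occurs.\<close>
  define cl where "cl v = (if G.ord v = p then 1 else if G.ord v = 2 then 2 else 0 :: nat)" for v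
  \<comment> \<open>The block pattern of A + I: the unordered pair covers both orientations, and
    \<open>S k k = 1\<close> holds because each class is a clique.\<close>
  define S :: "nat \<Rightarrow> nat \<Rightarrow> complex poly"
    where "S k l = (if {k, l} = {1, 2} then 0 else 1)" for k l
  have adj: "(u, v) \<in> parcs (superpower_graph ?G) \<longleftrightarrow> u \<noteq> v \<and> {cl u, cl v} \<noteq> {1, 2}"
    if "u \<in> carrier ?G" "v \<in> carrier ?G" for u v
  proof -
    have "\<not> p dvd 2" "\<not> 2 dvd p" using p p3 by (auto dest: dvd_imp_le)
    thus ?thesis
      using that ord_cases[OF that(1)] ord_cases[OF that(2)] p3
      by (auto simp: superpower_graph_def cl_def doubleton_eq_iff)
  qed
  \<comment> \<open>An order dividing a prime \<open>q\<close> is 1 or \<open>q\<close>; the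
    subtracted 1 is the identity.\<close>
  have card_prime: "card {v \<in> carrier ?G. G.ord v = q} = card {x \<in> carrier D. D.ord x dvd q} ^ 2 - 1"
    if "Factorial_Ring.prime q" for q :: nat
  proof -
    have "{v \<in> carrier ?G. G.ord v dvd q} = insert \<one>\<^bsub>?G\<^esub> {v \<in> carrier ?G. G.ord v = q}"
      using that G.ord_eq_1 by (auto simp: prime_nat_iff simp del: carrier_DirProd one_DirProd)
    moreover have "\<one>\<^bsub>?G\<^esub> \<notin> {v \<in> carrier ?G. G.ord v = q}"
      using that by (auto simp del: one_DirProd)
    ultimately have "card {v \<in> carrier ?G. G.ord v dvd q} = Suc (card {v \<in> carrier ?G. G.ord v = q})"
      using fin by (simp del: carrier_DirProd one_DirProd)
    thus ?thesis by (simp add: card_ord_dvd_DirProd[OF D_group D_group] power2_eq_square del: carrier_DirProd)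
  qed
  define N where "N l = card {i. i < length vs \<and> cl (vs ! i) = l}" for l
  have N_eq: "N l = card {v \<in> carrier ?G. cl v = l}" for l
  proof -
    have "bij_betw ((!) vs) {i. i < length vs \<and> cl (vs ! i) = l} {v \<in> set vs. cl v = l}"
      using vs(1)
      by (force simp: bij_betw_def inj_on_def nth_eq_iff_index_eq in_set_conv_nth image_iff)
    thus ?thesis unfolding N_def vs(2) by (rule bij_betw_same_card)
  qed
  have "{v \<in> carrier ?G. cl v = 1} = {v \<in> carrier ?G. G.ord v = p}"
    by (auto simp: cl_def)
  hence N1: "N 1 = p ^ 2 - 1"
    using card_prime[OF p(1)] dihedral_ord_counts(1)[OF D p(2)]
    by (simp add: N_eq del: carrier_DirProd)
  have "{v \<in> carrier ?G. cl v = 2} = {v \<in> carrier ?G. G.ord v = 2}"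
    using p by (auto simp: cl_def)
  hence N2: "N 2 = p ^ 2 + 2 * p"
    using card_prime[OF two_is_prime_nat] dihedral_ord_counts(2)[OF D p(2)]
    by (simp add: N_eq power2_eq_square del: carrier_DirProd)
  \<comment> \<open>The three classes partition the indices, so \<open>N 0\<close> follows from the
    total without counting elements of order 2p.\<close>
  have "{..<length vs} = (\<Union>l\<in>{0, 1, 2}. {i. i < length vs \<and> cl (vs ! i) = l})"
    by (auto simp: cl_def)
  hence "length vs = card (\<Union>l\<in>{0, 1, 2}. {i. i < length vs \<and> cl (vs ! i) = l})"
    by (metis card_lessThan)
  also have "\<dots> = (\<Sum>l\<in>{0, 1, 2}. N l)"
    unfolding N_def by (rule card_UN_disjoint) auto
  finally have N_sum: "N 0 + N 1 + N 2 = 4 * p ^ 2" by (simp add: len)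
  let ?A = "adjacency_matrix (superpower_graph ?G) vs"
  \<comment> \<open>On the diagonal, \<open>[:1, 1:]\<close> minus \<open>S k k = 1\<close> leaves
    the indeterminate, as it should since A has zero diagonal.\<close>
  have "char_poly_matrix ?A = mat (length vs) (length vs)
      (\<lambda>(i, j). (if i = j then [:1, 1:] else 0) - S (cl (vs ! i)) (cl (vs ! j)))"
    using vs(1) nth_mem[of _ vs]
    by (intro eq_matI) (auto simp: char_poly_matrix_def adjacency_matrix_def S_def adj vs(2)[symmetric]
      nth_eq_iff_index_eq doubleton_eq_iff one_pCons simp del: carrier_DirProd)
  hence "[:1, 1:] ^ 3 * char_poly ?A = [:1, 1:] ^ length vs * det (mat 3 3
      (\<lambda>(r, l). (if r = l then [:1, 1:] else 0) - S r l * of_nat (N l)))"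
    unfolding char_poly_def N_def
    by (simp only:, intro det_block_constant) (auto simp: cl_def)
  \<comment> \<open>With a generic \<open>t\<close> the expansion stays free of polynomial
    coefficients. The products N0 N1 and N0 N2 cancel in the linear term; only N1 N2, from the one
    incomparable pair of classes, survives.\<close>
  also have "det (mat 3 3 (\<lambda>(r, l). (if r = l then t else 0) - S r l * of_nat (N l))) =
    t ^ 3 - of_nat (N 0 + N 1 + N 2) * t ^ 2 + of_nat (N 1 * N 2) * t + of_nat (N 0 * N 1 * N 2)" for t
    by (simp add: det_mat_3 S_def doubleton_eq_iff) (simp add: algebra_simps eval_nat_numeral)
  also note N_sum
  also have "N 0 = 4 * p ^ 2 - (p ^ 2 - 1) - (p ^ 2 + 2 * p)"
    using N_sum N1 N2 by simp
  finally show ?thesis by (simp only: N1 N2 len)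
qed

theorem corollary3p1:
  fixes p :: nat and Dp :: "('a, 'm) monoid_scheme" and vs :: "('a \<times> 'a) list"
    and A B C D :: int
  assumes "Factorial_Ring.prime p" and "odd p"
    and "is_dihedral p Dp"
    and "distinct vs" and "set vs = pverts (superpower_graph (Dp \<times>\<times> Dp))"
    and "A = 4 - 4 * int p ^ 2"
    and "B = int p ^ 4 + 2 * int p ^ 3 - 13 * int p ^ 2 - 2 * int p + 6"
    and "C = 2 * int p ^ 6 + 2 * int p ^ 5 - 3 * int p ^ 4 + 4 * int p ^ 3 - 11 * int p ^ 2
             - 6 * int p + 4"
    and "D = 2 * int p ^ 6 + 2 * int p ^ 5 - 4 * int p ^ 4 + 2 * int p ^ 3 - 2 * int p ^ 2
             - 4 * int p + 1"
  shows "Coset.order (Dp \<times>\<times> Dp) = 4 * p ^ 2 \<and>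
         size (spectrum_mset (adjacency_matrix (superpower_graph (Dp \<times>\<times> Dp)) vs)) = 4 * p ^ 2 \<and>
         spectrum_mset (adjacency_matrix (superpower_graph (Dp \<times>\<times> Dp)) vs) =
           replicate_mset (4 * p ^ 2 - 4) (-1)
           + proots [:of_int D, of_int C, of_int B, of_int A, 1:]"
proof -
  let ?M = "adjacency_matrix (superpower_graph (Dp \<times>\<times> Dp)) vs"
  let ?t = "[:1, 1:] :: complex poly"
  let ?q = "[:of_int D, of_int C, of_int B, of_int A, 1:] :: complex poly"
  let ?a = "p ^ 2 - 1" and ?b = "p ^ 2 + 2 * p"
  let ?m = "4 * p ^ 2 - ?a - ?b"
  let ?c = "?t ^ 3 - of_nat (4 * p ^ 2) * ?t ^ 2 + of_nat (?a * ?b) * ?t + of_nat (?m * ?a * ?b)"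
  have vs: "set vs = carrier (Dp \<times>\<times> Dp)" using assms(5) by (simp add: superpower_graph_def)
  have order: "Coset.order (Dp \<times>\<times> Dp) = 4 * p ^ 2"
    using assms(3) by (simp add: is_dihedral_def Coset.order_def card_cartesian_product power2_eq_square)
  have len: "length vs = 4 * p ^ 2"
    using distinct_card[OF assms(4)] order vs by (simp add: Coset.order_def)
  have p2: "p \<ge> 2" using assms(1) by (rule prime_ge_2_nat)
  \<comment> \<open>Opaque names hide the truncated subtractions; their integer values are then
    supplied by \<open>a_eq\<close>, \<open>b_eq\<close> and \<open>m_eq\<close>, where nothing is
    truncated.\<close>
  obtain m a b where m: "m = ?m" and a: "a = ?a" and b: "b = ?b" by blast
  have a_eq: "int a = int p ^ 2 - 1" using p2 by (simp add: a of_nat_diff)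
  have b_eq: "int b = int p ^ 2 + 2 * int p" by (simp add: b)
  have "a + b \<le> 4 * p ^ 2"
    using p2 by (auto simp: a b power2_eq_square intro: order_trans[OF diff_le_self])
  hence "int m = int (4 * p ^ 2) - int a - int b" by (simp add: m a b of_nat_diff)
  hence m_eq: "int m = 2 * int p ^ 2 - 2 * int p + 1" by (simp add: a_eq b_eq)
  \<comment> \<open>These are the coefficients of t^4 - 4p^2 t^3 + ab t^2 + mab t expanded at t = x
    + 1.\<close>
  have A: "A = 4 - int (4 * p ^ 2)"
    and B: "B = 6 - 3 * int (4 * p ^ 2) + int a * int b"
    and C: "C = 4 - 3 * int (4 * p ^ 2) + 2 * (int a * int b) + int m * int a * int b"
    and D: "D = 1 - int (4 * p ^ 2) + int a * int b + int m * int a * int b"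
    by (simp_all add: assms(6-9) a_eq b_eq m_eq algebra_simps power_numeral_reduce)
  have "?t * ?c = ?q"
    unfolding m[symmetric] unfolding a[symmetric] b[symmetric] A B C D
    by (simp add: of_nat_poly eval_nat_numeral algebra_simps)
  \<comment> \<open>Three factors cancel against the left side and one turns the cubic into the
    quartic, which therefore always has the root -1.\<close>
  moreover have "?t ^ (4 * p ^ 2) = ?t ^ 3 * (?t ^ (4 * p ^ 2 - 4) * ?t)"
  proof -
    have "4 * p ^ 2 = 3 + ((4 * p ^ 2 - 4) + 1)" using p2 by (simp add: Suc_leI)
    thus ?thesis by (metis power_add power_one_right)
  qed
  ultimately have "?t ^ 3 * char_poly ?M = ?t ^ 3 * (?t ^ (4 * p ^ 2 - 4) * ?q)"
    using char_poly_superpower_dihedral_square[OF assms(1-4) vs] by (simp only: mult.assoc)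
  hence char: "char_poly ?M = ?t ^ (4 * p ^ 2 - 4) * ?q" by simp
  \<comment> \<open>Over the complex numbers the roots with multiplicity are as many as the
    degree.\<close>
  have "size (spectrum_mset ?M) = 4 * p ^ 2"
    using degree_monic_char_poly[of ?M "length vs"]
    by (simp add: spectrum_mset_def size_proots_complex adjacency_matrix_def len)
  moreover have "spectrum_mset ?M = replicate_mset (4 * p ^ 2 - 4) (-1) + proots ?q"
    unfolding spectrum_mset_def char
    by (subst proots_mult) (auto simp: proots_power repeat_mset_replicate_mset)
  ultimately show ?thesis using order by blast
qed

end
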